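(* Let $L_1, L_2 \subseteq \mathbb{R}^n$ be convex bodies, let $c, d \in \mathbb{R}^n$ be vectors, and let $r, R > 0$ be reals such that $r L_1 + c \subseteq \mathbb{B}^n \subseteq R L_2 + d$. Then the following conditions are equivalent: (i) The containment chain $r L_1 + c \subseteq \mathbb{B}^n \subseteq R L_2 + d$ is affinely-optimal. (ii) For any real symmetric matrix $A \in \mathbb{R}^{n \times n}$ and any vectors $v, w \in \mathbb{R}^n$, there exist an inner contact point $y \in \operatorname{bd}(\mathbb{B}^n) \cap \operatorname{bd}(r L_1 + c)$ and an outer contact point $z \in \operatorname{bd}(\mathbb{B}^n) \cap \operatorname{bd}(R L_2 + d)$ such that $$\langle y, A y + v \rangle \leq \langle z, A z + w \rangle.$$ (iii) There exist integers $N, M \geq 1$, inner contact points $y^1, \ldots, y^N \in \operatorname{bd}(\mathbb{B}^n) \cap \operatorname{bd}(r L_1 + c)$, outer contact points $z^1, \ldots, z^M \in \operatorname{bd}(\mathbb{B}^n) \cap \operatorname{bd}(R L_2 + d)$, as well as weights $\lambda_1, \ldots, \lambda_N, \mu_1, \ldots, \mu_M > 0$ such that for any $x \in \mathbb{R}^n$, $$\sum_{i=1}^N \lambda_i \langle x, y^i \rangle y^i = \sum_{j=1}^M \mu_j \langle x, z^j \rangle z^j \quad \text{and} \quad \sum_{i=1}^N \lambda_i y^i = \sum_{j=1}^M \mu_j z^j = 0.$$ In this case (i.e., for a decomposition as in (iii)), $\sum_{i=1}^N \lambda_i = \sum_{j=1}^M \mu_j$, and there exists a choice of the decomposition in (iii)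 with $N + M \leq \frac{n(n+5)}{2} + 1$.
   Context: A convex body in $\mathbb{R}^n$ is a compact convex set with non-empty interior. $\mathbb{B}^n$ is the (closed) Euclidean unit ball in $\mathbb{R}^n$, $\langle \cdot, \cdot \rangle$ is the standard inner product, and $\operatorname{bd}$ denotes boundary. For convex bodies $K, L_1, L_2 \subseteq \mathbb{R}^n$, vectors $c, d \in \mathbb{R}^n$, and reals $r, R > 0$ with $r L_1 + c \subseteq K \subseteq R L_2 + d$, this containment chain is called affinely-optimal if for any linear operator $T$ on $\mathbb{R}^n$, vectors $c', d' \in \mathbb{R}^n$, and reals $r', R' > 0$ with $r' L_1 + c' \subseteq T(K) \subseteq R' L_2 + d'$ we have $\frac{R'}{r'} \geq \frac{R}{r}$. (Here it is used with $K = \mathbb{B}^n$.) *)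

theory Defs
  imports "HOL-Analysis.Analysis"
begin

definition convex_body :: "(real ^ 'n) set \<Rightarrow> bool" where
  "convex_body K \<longleftrightarrow> compact K \<and> convex K \<and> interior K \<noteq> {}"

definition homothet :: "real \<Rightarrow> (real ^ 'n) set \<Rightarrow> real ^ 'n \<Rightarrow> (real ^ 'n) set" where
  "homothet r L c = (\<lambda>x. r *\<^sub>R x + c) ` L"

definition containment_chain ::
    "(real ^ 'n) set \<Rightarrow> (real ^ 'n) set \<Rightarrow> (real ^ 'n) set \<Rightarrow>
     real \<Rightarrow> real ^ 'n \<Rightarrow> real \<Rightarrow> real ^ 'n \<Rightarrow> bool" where
  "containment_chain L1 K L2 r c R d \<longleftrightarrow>
     homothet r L1 c \<subseteq> K \<and> K \<subseteq> homothet R L2 d"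

text \<open>The operator \<open>T\<close> may be singular and the translations \<open>c'\<close>, \<open>d'\<close> are independent of each other.\<close>

definition affinely_optimal ::
    "(real ^ 'n) set \<Rightarrow> (real ^ 'n) set \<Rightarrow> (real ^ 'n) set \<Rightarrow>
     real \<Rightarrow> real ^ 'n \<Rightarrow> real \<Rightarrow> real ^ 'n \<Rightarrow> bool" where
  "affinely_optimal L1 K L2 r c R d \<longleftrightarrow>
     containment_chain L1 K L2 r c R d \<and>
     (\<forall>T c' d' r' R'. linear (T :: real ^ 'n \<Rightarrow> real ^ 'n) \<and> r' > 0 \<and> R' > 0 \<and>
        containment_chain L1 (T ` K) L2 r' c' R' d' \<longrightarrow> R' / r' \<ge> R / r)"

definition contact_points :: "(real ^ 'n) set \<Rightarrow> (real ^ 'n) set \<Rightarrow> (real ^ 'n) set" where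
  "contact_points K L = frontier K \<inter> frontier L"

text \<open>Only the values of \<open>y\<close>, \<open>\<alpha>\<close> on \<open>{1..N}\<close> and of \<open>z\<close>, \<open>\<beta>\<close> on \<open>{1..M}\<close> matter;
  the points need not be distinct.\<close>

definition contact_decomposition ::
    "(real ^ 'n) set \<Rightarrow> (real ^ 'n) set \<Rightarrow> nat \<Rightarrow> nat \<Rightarrow>
     (nat \<Rightarrow> real ^ 'n) \<Rightarrow> (nat \<Rightarrow> real ^ 'n) \<Rightarrow> (nat \<Rightarrow> real) \<Rightarrow> (nat \<Rightarrow> real) \<Rightarrow> bool" where
  "contact_decomposition Y Z N M y z \<alpha> \<beta> \<longleftrightarrow>
     N \<ge> 1 \<and> M \<ge> 1 \<and>
     (\<forall>i\<in>{1..N}. y i \<in> Y \<and> \<alpha> i > 0) \<and>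
     (\<forall>j\<in>{1..M}. z j \<in> Z \<and> \<beta> j > 0) \<and>
     (\<forall>x. (\<Sum>i=1..N. (\<alpha> i * (x \<bullet> y i)) *\<^sub>R y i) = (\<Sum>j=1..M. (\<beta> j * (x \<bullet> z j)) *\<^sub>R z j)) \<and>
     (\<Sum>i=1..N. \<alpha> i *\<^sub>R y i) = 0 \<and>
     (\<Sum>j=1..M. \<beta> j *\<^sub>R z j) = 0"

end

theory Submission imports Defs begin

text \<open>
  Write \<open>K1 = r L1 + c\<close> and \<open>K2 = R L2 + d\<close>, so that \<open>K1 \<subseteq> B \<subseteq> K2\<close> for the unit ball \<open>B\<close>.
  The three conditions are related in a cycle: optimality implies that no pair of quadratic forms
  with common matrix separates the inner from the outer contact points, this implies a decomposition
  of the claimed size, and any decomposition implies optimality.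

  Suppose that \<open>A\<close>, \<open>v\<close>, \<open>w\<close> separate the contact points. A multiple of the identity can be added to
  \<open>A\<close> without affecting the separation, so \<open>y \<bullet> (A y + v)\<close> is positive at inner and
  \<open>z \<bullet> (A z + w)\<close> is negative at outer contact points. To first order in \<open>e\<close>, the support function
  of \<open>(I + e A) B\<close> in a unit direction \<open>u\<close> is \<open>1 + e (u \<bullet> A u)\<close>. Hence \<open>(I + e A) B + e w\<close> is still
  contained in \<open>K2\<close>, while \<open>(I + e A) B\<close> contains even a dilate of \<open>K1 - e v\<close> with
  factor \<open>\<rho> > 1\<close>: directions near the contact points are handled by the sign of the forms and
  all others by compactness. This improves the chain (\<open>improved_chain\<close>).

  If nothing separates, then \<open>0\<close> lies in the convex hull of the points \<open>(y y\<^sup>T, y, 0)\<close> and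
  \<open>- (z z\<^sup>T, 0, z)\<close>, since a hyperplane strictly missing \<open>0\<close> would be a separating triple
  \<open>(A, v, w)\<close> (\<open>zero_in_moment_hull\<close>). A convex combination equal to \<open>0\<close> is a contact
  decomposition, and Caratheodory's theorem bounds its length: the symmetric matrices together with
  two copies of the space have dimension \<open>n (n + 1) / 2 + 2 n = n (n + 5) / 2\<close>.

  Conversely, consider a decomposition and a chain in which \<open>T B\<close> contains a translate of \<open>\<rho> K1\<close> and
  lies in a translate of \<open>P K2\<close>. With \<open>W\<close> the inverse of \<open>T\<close>, the inner contact points bound the
  weighted sum of \<open>norm (W y)\<^sup>2\<close> from above by \<open>\<Lambda> / \<rho>\<^sup>2\<close>, where \<open>\<Lambda>\<close> is the total weight, and the
  outer ones bound that of \<open>1 / norm (W z)\<close> from above by \<open>P \<Lambda>\<close>; the translations cancel because the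
  contact points are weighted to have centroid \<open>0\<close>. The decomposition says that the sums of squares
  over \<open>y\<close> and \<open>z\<close> agree, and convexity of \<open>1 / sqrt\<close> then gives \<open>\<rho> \<le> P\<close>
  (\<open>decomposition_optimal\<close>).
\<close>

section \<open>Contact points and supporting hyperplanes\<close>

lemma separating_unit_normal:
  fixes S :: "'a::euclidean_space set"
  assumes "convex S" "closed S" "S \<noteq> {}" "p \<notin> S"
  obtains u where "norm u = 1" "\<And>q. q \<in> S \<Longrightarrow> u \<bullet> q < u \<bullet> p"
proof -
  obtain a b where ab: "a \<bullet> p < b" "\<And>q. q \<in> S \<Longrightarrow> b < a \<bullet> q"
    using separating_hyperplane_closed_point[OF assms(1,2,4)] by blast
  have "a \<noteq> 0"
    using ab \<open>S \<noteq> {}\<close> by fastforce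
  define u where "u = - (a /\<^sub>R norm a)"
  have "norm u = 1"
    using \<open>a \<noteq> 0\<close> by (simp add: u_def)
  moreover have "u \<bullet> q < u \<bullet> p" if "q \<in> S" for q
  proof -
    have "a \<bullet> p < a \<bullet> q"
      using ab(1) ab(2)[OF that] by linarith
    then show ?thesis
      using \<open>a \<noteq> 0\<close> by (simp add: u_def divide_simps)
  qed
  ultimately show ?thesis
    using that by blast
qed

text \<open>
  A hyperplane supporting \<open>K\<close> at \<open>z\<close> also supports the ball at \<open>z\<close>, and the ball is smooth:
  its only supporting hyperplane there is the tangent.
\<close>

lemma frontier_outer_contact_le_1:
  fixes K :: "'a::euclidean_space set"
  assumes "convex K" "closed K" "cball 0 1 \<subseteq> K" "z \<in> frontier K" "norm z = 1" "x \<in> K"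
  shows "x \<bullet> z \<le> 1"
proof -
  have "z \<in> K" "z \<notin> interior K"
    using assms by (auto simp: frontier_def closure_closed)
  moreover have "interior K \<noteq> {}"
    using interior_mono[OF assms(3)] by (auto simp: interior_cball)
  ultimately have "z \<notin> rel_interior K"
    by (simp add: rel_interior_nonempty_interior)
  then obtain a where a: "a \<noteq> 0" "\<And>y. y \<in> K \<Longrightarrow> a \<bullet> z \<le> a \<bullet> y"
    using supporting_hyperplane_rel_boundary[OF \<open>convex K\<close> \<open>z \<in> K\<close>] by metis
  have "a \<bullet> z \<le> a \<bullet> (- (a /\<^sub>R norm a))"
    using a(1) by (intro a(2) subsetD[OF assms(3)]) simp
  also have "\<dots> = - norm a"
    using a(1) by (simp add: dot_square_norm power2_eq_square)
  finally have "(- a) \<bullet> z \<ge> norm (- a) * norm z"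
    using assms(5) by simp
  \<comment> \<open>Equality in Cauchy-Schwarz: the supporting hyperplane at \<open>z\<close> is the tangent of the ball.\<close>
  then have "(- a) \<bullet> z = norm (- a) * norm z"
    using norm_cauchy_schwarz[of "- a" z] by linarith
  then have "norm a *\<^sub>R z = - a"
    unfolding norm_cauchy_schwarz_eq using assms(5) by simp
  then have eq: "a = - (norm a *\<^sub>R z)"
    by simp
  have "norm a * (x \<bullet> z) \<le> norm a * (z \<bullet> z)"
  proof -
    have "a \<bullet> z = - (norm a * (z \<bullet> z))" "a \<bullet> x = - (norm a * (x \<bullet> z))"
      by (subst eq, simp add: inner_commute)+
    then show ?thesis
      using a(2)[OF assms(6)] by linarith
  qed
  then show ?thesis
    using a(1) assms(5) by (simp add: dot_square_norm)
qed

lemma contact_points_cball_inside: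
  fixes K :: "(real ^ 'n) set"
  assumes "closed K" "K \<subseteq> cball 0 1"
  shows "contact_points (cball 0 1) K = K \<inter> sphere 0 1"
proof -
  have "sphere 0 1 \<inter> interior K = {}"
    using interior_mono[OF assms(2)] by (auto simp: interior_cball)
  then show ?thesis
    using assms(1) by (auto simp: contact_points_def frontier_def closure_closed)
qed

lemma contact_points_cball:
  fixes K :: "(real ^ 'n) set"
  shows "contact_points (cball 0 1) K = sphere 0 1 \<inter> frontier K"
  by (simp add: contact_points_def)

lemma compact_homothet: "compact L \<Longrightarrow> compact (homothet r L c)"
  unfolding homothet_def by (intro compact_continuous_image continuous_intros)

lemma convex_homothet: "convex L \<Longrightarrow> convex (homothet r L c)"
  unfolding homothet_def by (rule convex_affinity[of L c r, unfolded add.commute[of c]])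

section \<open>First-order perturbations of the unit ball\<close>

text \<open>
  Near the contact points, where the form is positive, \<open>(I + e A) B\<close> extends beyond \<open>K - e v\<close>,
  which leaves room to dilate \<open>K - e v\<close>. If a dilated point were outside, a unit normal \<open>u\<close> would
  separate it from \<open>(I + e A) B\<close>. Either the form exceeds \<open>\<delta>\<close> at \<open>u\<close>, and the single point
  \<open>(I + e A) u\<close> refutes the separation; or \<open>u\<close> stays away from \<open>K\<close>, and \<open>K\<close> ends at a uniform
  distance \<open>\<eta>\<close> before the tangent hyperplane at \<open>u\<close>, more than a small perturbation can overcome.
\<close>

lemma inner_perturbation:
  fixes A :: "'a::euclidean_space \<Rightarrow> 'a"
  assumes "linear A" "compact K" "K \<subseteq> cball 0 1"
    and \<delta>: "\<delta> > 0" "\<And>y. y \<in> K \<Longrightarrow> norm y = 1 \<Longrightarrow> \<delta> < y \<bullet> (A y + v)"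
  shows "\<forall>\<^sub>F e in at_right 0. \<exists>\<rho>>1. \<forall>x\<in>K. \<rho> *\<^sub>R (x - e *\<^sub>R v) \<in> (\<lambda>x. x + e *\<^sub>R A x) ` cball 0 1"
proof -
  obtain B where B: "B > 0" "\<And>x. norm (A x) \<le> B * norm x"
    using linear_bounded_pos[OF assms(1)] by blast
  define V where "V = norm v"
  have "V \<ge> 0"
    by (simp add: V_def)
  have contA: "continuous_on S A" for S
    using assms(1) by (simp add: linear_continuous_on linear_linear)
  define far where "far = sphere 0 1 \<inter> {u. u \<bullet> (A u + v) \<le> \<delta>}"
  have "closed far"
    unfolding far_def by (intro closed_Int closed_sphere closed_Collect_le continuous_intros contA)
  moreover have "K \<inter> far = {}"
    using \<delta>(2) by (force simp: far_def)
  ultimately obtain d where d: "d > 0" "\<And>x u. x \<in> K \<Longrightarrow> u \<in> far \<Longrightarrow> d \<le> dist x u"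
    using separate_compact_closed[OF \<open>compact K\<close>, of far] by auto
  define \<eta> where "\<eta> = d\<^sup>2 / 2"
  have "\<eta> > 0"
    using d(1) by (simp add: \<eta>_def)
  \<comment> \<open>For vectors in the ball, being at distance \<open>d\<close> from \<open>u\<close> costs \<open>d\<^sup>2 / 2\<close> in the direction \<open>u\<close>.\<close>
  have far_le: "u \<bullet> x \<le> 1 - \<eta>" if "u \<in> far" "x \<in> K" for u x
  proof -
    have "norm x \<le> 1" "norm u = 1"
      using that assms(3) by (auto simp: far_def)
    have "d\<^sup>2 \<le> (norm (x - u))\<^sup>2"
      using d(1) d(2)[OF that(2,1)] by (simp add: dist_norm power_mono)
    also have "\<dots> = (norm x)\<^sup>2 + 1 - 2 * (u \<bullet> x)"
      using \<open>norm u = 1\<close> by (simp add: power2_norm_eq_inner inner_diff inner_commute norm_eq_1)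
    also have "\<dots> \<le> 2 - 2 * (u \<bullet> x)"
      using \<open>norm x \<le> 1\<close> by (simp add: power_le_one)
    finally show ?thesis
      by (simp add: \<eta>_def)
  qed
  have "\<exists>\<rho>>1. \<forall>x\<in>K. \<rho> *\<^sub>R (x - e *\<^sub>R v) \<in> (\<lambda>x. x + e *\<^sub>R A x) ` cball 0 1"
    if e: "0 < e" "e < \<eta> / (B + V + \<delta>)" for e
  proof -
    have e\<eta>: "e * (B + V + \<delta>) < \<eta>"
      using e B(1) \<open>V \<ge> 0\<close> \<delta>(1) by (simp add: pos_less_divide_eq)
    \<comment> \<open>The margin \<open>e * \<delta>\<close> won near the contact points pays for the dilation.\<close>
    define s where "s = e * \<delta> / (1 + e * V)"
    have eV: "1 + e * V > 0"
      using e(1) \<open>V \<ge> 0\<close> by (simp add: add_pos_nonneg)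
    have s: "s > 0" "s * (1 + e * V) = e * \<delta>"
      using e(1) \<delta>(1) eV by (auto simp: s_def)
    let ?T = "\<lambda>x. x + e *\<^sub>R A x"
    have "(1 + s) *\<^sub>R (x - e *\<^sub>R v) \<in> ?T ` cball 0 1" if "x \<in> K" for x
    proof (rule ccontr)
      assume out: "(1 + s) *\<^sub>R (x - e *\<^sub>R v) \<notin> ?T ` cball 0 1"
      have linT: "linear ?T"
        using assms(1) by (intro linear_compose_add linear_ident linear_compose_scale_right)
      have "compact (?T ` cball 0 1)"
        by (intro compact_continuous_image continuous_intros contA compact_cball)
      moreover have "convex (?T ` cball 0 1)"
        by (intro convex_linear_image linT convex_cball)
      moreover have "?T ` cball 0 1 \<noteq> {}"
        by simp
      ultimately obtain u where u: "norm u = 1"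
          "\<And>q. q \<in> ?T ` cball 0 1 \<Longrightarrow> u \<bullet> q < u \<bullet> ((1 + s) *\<^sub>R (x - e *\<^sub>R v))"
        using separating_unit_normal[OF _ compact_imp_closed _ out] by metis
      have uv: "\<bar>u \<bullet> v\<bar> \<le> V"
        using Cauchy_Schwarz_ineq2[of u v] u(1) by (simp add: V_def)
      have uA: "\<bar>u \<bullet> A u\<bar> \<le> B"
        using Cauchy_Schwarz_ineq2[of u "A u"] B(2)[of u] u(1) by simp
      have "u \<bullet> ?T u < (1 + s) * (u \<bullet> (x - e *\<^sub>R v))"
        using u(2)[of "?T u"] u(1) by simp
      then have main: "1 + e * (u \<bullet> A u) < (1 + s) * (u \<bullet> x - e * (u \<bullet> v))"
        using u(1) by (simp add: inner_simps norm_eq_1)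
      have ux: "u \<bullet> x \<le> 1"
        using norm_cauchy_schwarz[of u x] u(1) \<open>x \<in> K\<close> assms(3) by fastforce
      have "e * \<bar>u \<bullet> v\<bar> \<le> e * V"
        using uv e(1) by (simp add: mult_left_mono)
      then have "u \<bullet> x - e * (u \<bullet> v) \<le> 1 + e * V"
        using ux e(1) by (smt (verit) abs_ge_minus_self mult_left_mono mult_minus_right)
      then have "s * (u \<bullet> x - e * (u \<bullet> v)) \<le> e * \<delta>"
        using s by (metis less_eq_real_def mult_left_mono)
      with main have main2: "1 + e * (u \<bullet> A u + u \<bullet> v) < u \<bullet> x + e * \<delta>"
        by (simp add: algebra_simps)
      show False
      proof (cases "u \<in> far")
        case True
        have "- (B + V) \<le> u \<bullet> A u + u \<bullet> v"
          using uv uA by linarith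
        then have "e * (- (B + V)) \<le> e * (u \<bullet> A u + u \<bullet> v)"
          using e(1) by (simp add: mult_left_mono del: mult_minus_right)
        then show False
          using main2 far_le[OF True \<open>x \<in> K\<close>] e\<eta> by (simp add: algebra_simps)
      next
        case False
        then have "\<delta> < u \<bullet> A u + u \<bullet> v"
          using u(1) by (simp add: far_def inner_simps)
        then have "e * \<delta> < e * (u \<bullet> A u + u \<bullet> v)"
          using e(1) by simp
        then show False
          using main2 ux by linarith
      qed
    qed
    then show ?thesis
      using s(1) by (intro exI[of _ "1 + s"]) simp
  qed
  moreover have "\<eta> / (B + V + \<delta>) > 0"
    using \<open>\<eta> > 0\<close> B(1) \<open>V \<ge> 0\<close> \<delta>(1) by simp
  ultimately show ?thesis
    unfolding eventually_at_right_field by blast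
qed

text \<open>
  The outer counterpart. A unit normal \<open>u\<close> cutting a point of \<open>(I + e A) B + e w\<close> off \<open>K\<close> has
  \<open>u \<bullet> (I + e A) x \<le> norm (u + e A u)\<close> for symmetric \<open>A\<close>, which is \<open>1 + e (u \<bullet> A u)\<close> up to second
  order. When the form is below \<open>- \<delta>\<close> at \<open>u\<close>, the point \<open>u\<close> of \<open>K\<close> already lies beyond the cut;
  otherwise \<open>u\<close> is uniformly interior and \<open>(1 + \<eta>) u\<close> does.
\<close>

lemma outer_perturbation:
  fixes A :: "'a::euclidean_space \<Rightarrow> 'a"
  assumes "linear A" "\<And>x y. A x \<bullet> y = x \<bullet> A y"
    and K: "convex K" "closed K" "cball 0 1 \<subseteq> K"
    and \<delta>: "\<delta> > 0" "\<And>z. z \<in> frontier K \<Longrightarrow> norm z = 1 \<Longrightarrow> z \<bullet> (A z + w) < - \<delta>"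
  shows "\<forall>\<^sub>F e in at_right 0. \<forall>x\<in>cball 0 1. x + e *\<^sub>R A x + e *\<^sub>R w \<in> K"
proof -
  obtain B where B: "B > 0" "\<And>x. norm (A x) \<le> B * norm x"
    using linear_bounded_pos[OF assms(1)] by blast
  define W where "W = norm w"
  have "W \<ge> 0"
    by (simp add: W_def)
  have contA: "continuous_on S A" for S
    using assms(1) by (simp add: linear_continuous_on linear_linear)
  define far where "far = sphere 0 1 \<inter> {u. - \<delta> \<le> u \<bullet> (A u + w)}"
  have "compact far"
    unfolding far_def
    by (intro compact_Int_closed compact_sphere closed_Collect_le continuous_intros contA)
  moreover have "far \<inter> - interior K = {}"
  proof -
    have "u \<in> interior K" if "u \<in> far" for u
    proof (rule ccontr)
      assume "u \<notin> interior K"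
      moreover have "norm u = 1" "u \<in> K"
        using that K(3) by (auto simp: far_def)
      ultimately show False
        using that \<delta>(2)[of u] K(2) by (simp add: far_def frontier_def)
    qed
    then show ?thesis
      by blast
  qed
  ultimately obtain d where d: "d > 0" "\<And>u p. u \<in> far \<Longrightarrow> p \<notin> interior K \<Longrightarrow> d \<le> dist u p"
    using separate_compact_closed[of far "- interior K"] by (auto simp: closed_Compl)
  define \<eta> where "\<eta> = d / 2"
  have "\<eta> > 0" "\<eta> < d"
    using d(1) by (auto simp: \<eta>_def)
  have far_in: "(1 + \<eta>) *\<^sub>R u \<in> K" if "u \<in> far" for u
  proof -
    have "dist u ((1 + \<eta>) *\<^sub>R u) = \<eta>"
      using that \<open>\<eta> > 0\<close> by (simp add: dist_norm far_def algebra_simps)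
    then have "(1 + \<eta>) *\<^sub>R u \<in> interior K"
      using d(2)[OF that, of "(1 + \<eta>) *\<^sub>R u"] \<open>\<eta> < d\<close> by fastforce
    then show ?thesis
      using interior_subset by blast
  qed
  define e0 where "e0 = min (2 * \<delta> / B\<^sup>2) (\<eta> / (B + W + \<delta>))"
  have "x + e *\<^sub>R A x + e *\<^sub>R w \<in> K"
    if e: "0 < e" "e < e0" and x: "x \<in> cball 0 1" for e x
  proof (rule ccontr)
    assume "x + e *\<^sub>R A x + e *\<^sub>R w \<notin> K"
    moreover have "K \<noteq> {}"
      using K(3) by auto
    ultimately obtain u where u: "norm u = 1"
        "\<And>q. q \<in> K \<Longrightarrow> u \<bullet> q < u \<bullet> (x + e *\<^sub>R A x + e *\<^sub>R w)"
      using separating_unit_normal[OF K(1,2)] by blast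
    define t where "t = u + e *\<^sub>R A u"
    have uw: "u \<bullet> w \<le> W"
      using norm_cauchy_schwarz[of u w] u(1) by (simp add: W_def)
    have uA: "u \<bullet> A u \<le> B"
      using norm_cauchy_schwarz[of u "A u"] B(2)[of u] u(1) by simp
    have "e < 2 * \<delta> / B\<^sup>2" "e < \<eta> / (B + W + \<delta>)"
      using e(2) by (auto simp: e0_def)
    then have e\<delta>: "e * B\<^sup>2 < 2 * \<delta>" and e\<eta>: "e * (B + W + \<delta>) < \<eta>"
      using B(1) \<open>W \<ge> 0\<close> \<delta>(1) by (auto simp: pos_less_divide_eq)
    have "(norm (A u))\<^sup>2 \<le> B\<^sup>2"
      using B(2)[of u] u(1) by (simp add: power_mono)
    then have sq: "e * (e * (norm (A u))\<^sup>2) < e * (2 * \<delta>)"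
      using e(1) e\<delta> by (intro mult_strict_left_mono le_less_trans[OF _ e\<delta>] mult_left_mono) auto
    have "u \<bullet> (x + e *\<^sub>R A x) = t \<bullet> x"
      by (simp add: t_def inner_simps assms(2))
    also have "\<dots> \<le> norm t"
      using norm_cauchy_schwarz[of t x] x mult_left_mono[of "norm x" 1 "norm t"] by simp
    \<comment> \<open>The tangent of the square root at \<open>1\<close> turns the norm into a quadratic expression.\<close>
    also have "\<dots> \<le> (1 + (norm t)\<^sup>2) / 2"
      using sum_squares_bound[of "norm t" 1] by (simp add: field_simps)
    also have "(norm t)\<^sup>2 = 1 + 2 * e * (u \<bullet> A u) + e * (e * (norm (A u))\<^sup>2)"
      using u(1) by (simp add: t_def power2_norm_eq_inner inner_simps norm_eq_1 assms(2)
          algebra_simps inner_commute)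
    finally have bound: "u \<bullet> (x + e *\<^sub>R A x + e *\<^sub>R w) < 1 + e * (u \<bullet> (A u + w)) + e * \<delta>"
      using sq by (simp add: inner_simps algebra_simps)
    show False
    proof (cases "u \<in> far")
      case True
      have "u \<bullet> (A u + w) \<le> B + W"
        using uw uA by (simp add: inner_simps)
      then have "e * (u \<bullet> (A u + w)) \<le> e * (B + W)"
        using e(1) by simp
      moreover have "u \<bullet> ((1 + \<eta>) *\<^sub>R u) = 1 + \<eta>"
        using u(1) by (simp add: norm_eq_1)
      ultimately show False
        using u(2)[OF far_in[OF True]] bound e\<eta> by (simp add: algebra_simps)
    next
      case False
      then have "u \<bullet> (A u + w) < - \<delta>"
        using u(1) by (simp add: far_def)
      then have "e * (u \<bullet> (A u + w)) < e * (- \<delta>)"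
        using e(1) mult_strict_left_mono by blast
      moreover have "u \<in> K" "u \<bullet> u = 1"
        using u(1) K(3) by (auto simp flip: norm_eq_1)
      ultimately show False
        using u(2)[of u] bound by simp
    qed
  qed
  moreover have "e0 > 0"
    using \<open>\<eta> > 0\<close> B(1) \<open>W \<ge> 0\<close> \<delta>(1) by (simp add: e0_def)
  ultimately show ?thesis
    unfolding eventually_at_right_field by blast
qed

text \<open>
  One of the sets may be empty, which corresponds to a missing kind of contact points.
\<close>

lemma compact_threshold:
  fixes S T :: "real set"
  assumes "compact S" "compact T" "\<And>s t. s \<in> S \<Longrightarrow> t \<in> T \<Longrightarrow> t < s"
  obtains m \<delta> where "\<delta> > 0" "\<And>s. s \<in> S \<Longrightarrow> m + \<delta> < s" "\<And>t. t \<in> T \<Longrightarrow> t < m - \<delta>"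
proof -
  consider "S = {}" "T = {}" | "S = {}" "T \<noteq> {}" | "S \<noteq> {}" "T = {}" | "S \<noteq> {}" "T \<noteq> {}"
    by blast
  then show ?thesis
  proof cases
    case 1
    then show ?thesis
      using that[of 1] by simp
  next
    case 2
    then obtain b where b: "\<And>t. t \<in> T \<Longrightarrow> t \<le> b"
      using compact_attains_sup[OF assms(2)] by blast
    show ?thesis
      by (rule that[of 1 "b + 2"]) (use 2 in \<open>auto dest: b\<close>)
  next
    case 3
    then obtain a where a: "\<And>s. s \<in> S \<Longrightarrow> a \<le> s"
      using compact_attains_inf[OF assms(1)] by blast
    show ?thesis
      by (rule that[of 1 "a - 2"]) (use 3 in \<open>auto dest: a\<close>)
  next
    case 4
    obtain a where a: "a \<in> S" "\<And>s. s \<in> S \<Longrightarrow> a \<le> s"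
      using compact_attains_inf[OF assms(1) 4(1)] by blast
    obtain b where b: "b \<in> T" "\<And>t. t \<in> T \<Longrightarrow> t \<le> b"
      using compact_attains_sup[OF assms(2) 4(2)] by blast
    have "b < a"
      using assms(3) a(1) b(1) by blast
    show ?thesis
    proof (rule that[of "(a - b) / 3" "(a + b) / 2"])
      show "(a - b) / 3 > 0"
        using \<open>b < a\<close> by simp
      show "(a + b) / 2 + (a - b) / 3 < s" if "s \<in> S" for s
        using a(2)[OF that] \<open>b < a\<close> by (simp add: field_simps)
      show "t < (a + b) / 2 - (a - b) / 3" if "t \<in> T" for t
        using b(2)[OF that] \<open>b < a\<close> by (simp add: field_simps)
    qed
  qed
qed

text \<open>
  Separated contact points make the chain improvable: the outer factor is kept, while the inner one
  grows by \<open>\<rho>\<close>.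
\<close>

lemma improved_chain:
  fixes A :: "'a::euclidean_space \<Rightarrow> 'a"
  assumes "linear A" and selfadj: "\<And>x y. A x \<bullet> y = x \<bullet> A y"
    and K1: "compact K1" "K1 \<subseteq> cball 0 1"
    and K2: "convex K2" "closed K2" "cball 0 1 \<subseteq> K2"
    and sep: "\<And>y z. \<lbrakk>y \<in> K1; norm y = 1; z \<in> frontier K2; norm z = 1\<rbrakk>
      \<Longrightarrow> z \<bullet> (A z + w) < y \<bullet> (A y + v)"
  obtains T :: "'a \<Rightarrow> 'a" and \<rho> e where "linear T" "\<rho> > 1" "\<forall>x\<in>K1. \<rho> *\<^sub>R (x - e *\<^sub>R v) \<in> T ` cball 0 1"
    "\<forall>x\<in>cball 0 1. T x + e *\<^sub>R w \<in> K2"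
proof -
  have contA: "continuous_on S A" for S
    using assms(1) by (simp add: linear_continuous_on linear_linear)
  let ?Y = "K1 \<inter> sphere 0 1" and ?Z = "sphere 0 1 \<inter> frontier K2"
  have "compact ((\<lambda>y. y \<bullet> (A y + v)) ` ?Y)"
    using K1(1) by (intro compact_continuous_image continuous_intros contA compact_Int_closed closed_sphere)
  moreover have "compact ((\<lambda>z. z \<bullet> (A z + w)) ` ?Z)"
    by (intro compact_continuous_image continuous_intros contA compact_Int_closed compact_sphere
        frontier_closed)
  ultimately obtain m \<delta> where m0: "\<delta> > 0" "\<And>s. s \<in> (\<lambda>y. y \<bullet> (A y + v)) ` ?Y \<Longrightarrow> m + \<delta> < s"
      "\<And>t. t \<in> (\<lambda>z. z \<bullet> (A z + w)) ` ?Z \<Longrightarrow> t < m - \<delta>"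
  proof (rule compact_threshold)
    fix s t assume "s \<in> (\<lambda>y. y \<bullet> (A y + v)) ` ?Y" "t \<in> (\<lambda>z. z \<bullet> (A z + w)) ` ?Z"
    then show "t < s"
      using sep by auto
  qed blast
  then have m: "\<delta> > 0" "\<And>y. y \<in> ?Y \<Longrightarrow> m + \<delta> < y \<bullet> (A y + v)"
      "\<And>z. z \<in> ?Z \<Longrightarrow> z \<bullet> (A z + w) < m - \<delta>"
    by blast+
  \<comment> \<open>On unit vectors, subtracting \<open>m\<close> times the identity from \<open>A\<close> lowers both forms by \<open>m\<close>.\<close>
  define A' where "A' x = A x - m *\<^sub>R x" for x
  have shift: "u \<bullet> (A' u + b) = u \<bullet> (A u + b) - m" if "norm u = 1" for u b
    using that by (simp add: A'_def inner_simps norm_eq_1)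
  have "linear A'"
    unfolding A'_def[abs_def] using assms(1)
    by (intro linear_compose_sub linear_compose_scale_right linear_ident)
  have "\<And>x y. A' x \<bullet> y = x \<bullet> A' y"
    by (simp add: A'_def inner_simps selfadj)
  have "\<forall>\<^sub>F e in at_right 0. \<exists>\<rho>>1. \<forall>x\<in>K1. \<rho> *\<^sub>R (x - e *\<^sub>R v) \<in> (\<lambda>x. x + e *\<^sub>R A' x) ` cball 0 1"
    (is "eventually ?inner _")
    using inner_perturbation[OF \<open>linear A'\<close> K1 m(1)] m(2) shift by force
  moreover have "\<forall>\<^sub>F e in at_right 0. \<forall>x\<in>cball 0 1. x + e *\<^sub>R A' x + e *\<^sub>R w \<in> K2"
    (is "eventually ?outer _")
    using outer_perturbation[OF \<open>linear A'\<close> \<open>\<And>x y. A' x \<bullet> y = x \<bullet> A' y\<close> K2 m(1)] m(3) shift by force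
  ultimately have "\<exists>e. ?inner e \<and> ?outer e"
    by (intro eventually_happens'[OF trivial_limit_at_right_real] eventually_conj)
  then obtain e where "?inner e \<and> ?outer e"
    by (elim exE) (rule that)
  then obtain \<rho> where "\<rho> > 1" "\<forall>x\<in>K1. \<rho> *\<^sub>R (x - e *\<^sub>R v) \<in> (\<lambda>x. x + e *\<^sub>R A' x) ` cball 0 1"
    and "\<forall>x\<in>cball 0 1. x + e *\<^sub>R A' x + e *\<^sub>R w \<in> K2"
    by blast
  moreover have "linear (\<lambda>x. x + e *\<^sub>R A' x)"
    using \<open>linear A'\<close> by (intro linear_compose_add linear_ident linear_compose_scale_right)
  ultimately show ?thesis
    by (intro that[of "\<lambda>x. x + e *\<^sub>R A' x" \<rho> e])
qed

section \<open>Contact decompositions certify optimality\<close>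

text \<open>
  The two sides represent the same operator, hence the same quadratic form, and
  \<open>norm (W x)\<^sup>2\<close> is a sum of squares of linear forms in \<open>x\<close>. For \<open>W\<close> the identity this is the
  equality of the traces.
\<close>

lemma decomposition_quadratic:
  fixes y :: "'i \<Rightarrow> 'a::euclidean_space" and z :: "'j \<Rightarrow> 'a"
  assumes eq: "\<And>x. (\<Sum>i\<in>I. (\<alpha> i * (x \<bullet> y i)) *\<^sub>R y i) = (\<Sum>j\<in>J. (\<beta> j * (x \<bullet> z j)) *\<^sub>R z j)"
    and "linear (W :: 'a \<Rightarrow> 'b::euclidean_space)"
  shows "(\<Sum>i\<in>I. \<alpha> i * (norm (W (y i)))\<^sup>2) = (\<Sum>j\<in>J. \<beta> j * (norm (W (z j)))\<^sup>2)"
proof -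
  have form: "(\<Sum>i\<in>I. \<alpha> i * (x \<bullet> y i)\<^sup>2) = (\<Sum>j\<in>J. \<beta> j * (x \<bullet> z j)\<^sup>2)" for x
    using arg_cong[OF eq[of x], of "inner x"]
    by (simp add: inner_sum_right power2_eq_square mult.assoc)
  have nW: "(norm (W x))\<^sup>2 = (\<Sum>b\<in>Basis. (adjoint W b \<bullet> x)\<^sup>2)" for x
  proof -
    have "W x \<bullet> b = adjoint W b \<bullet> x" for b
      using adjoint_works[OF \<open>linear W\<close>, of x b] by (simp add: inner_commute)
    then show ?thesis
      unfolding power2_norm_eq_inner by (subst euclidean_inner) (simp add: power2_eq_square)
  qed
  show ?thesis
    unfolding nW sum_distrib_left by (subst (1 2) sum.swap) (simp add: form)
qed

lemma decomposition_trace: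
  fixes y :: "'i \<Rightarrow> 'a::euclidean_space" and z :: "'j \<Rightarrow> 'a"
  assumes "\<And>x. (\<Sum>i\<in>I. (\<alpha> i * (x \<bullet> y i)) *\<^sub>R y i) = (\<Sum>j\<in>J. (\<beta> j * (x \<bullet> z j)) *\<^sub>R z j)"
    and "\<And>i. i \<in> I \<Longrightarrow> norm (y i) = 1" "\<And>j. j \<in> J \<Longrightarrow> norm (z j) = 1"
  shows "sum \<alpha> I = sum \<beta> J"
  using decomposition_quadratic[OF assms(1) linear_ident] assms(2,3) by simp

text \<open>
  The tangent at \<open>t = 1 / \<rho>\<^sup>2\<close> to the convex function \<open>1 / sqrt t\<close>, evaluated at \<open>t = s\<^sup>2\<close>.
\<close>

lemma cubic_tangent_bound:
  fixes \<rho> s :: real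
  assumes "\<rho> > 0" "s > 0"
  shows "3 / 2 * \<rho> - \<rho> ^ 3 / 2 * s\<^sup>2 \<le> 1 / s"
proof -
  have "0 \<le> (\<rho> * s - 1)\<^sup>2 * (\<rho> * s + 2)"
    using assms by simp
  also have "\<dots> = (\<rho> * s) ^ 3 - 3 * (\<rho> * s) + 2"
    by (simp add: power2_eq_square power3_eq_cube algebra_simps)
  finally show ?thesis
    using assms(2) by (simp add: field_simps power2_eq_square power3_eq_cube)
qed

text \<open>
  The map \<open>W\<close> is the inverse of the transformation \<open>T\<close> of a competing chain: \<open>inner\<close> says that the
  image of the inner contact point \<open>y i\<close> lies in \<open>T B\<close>, and \<open>outer\<close> that the boundary point of \<open>T B\<close>
  on the ray through \<open>z j\<close>, which is \<open>z j / norm (W (z j))\<close>, lies below the supporting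
  hyperplane of the enclosing body with normal \<open>z j\<close>. This point, rather than a maximiser of
  the support function of \<open>T B\<close>, is used because its length involves the same map \<open>W\<close> as
  \<open>inner\<close> even when \<open>T\<close> is not symmetric.
\<close>

lemma decomposition_optimal:
  fixes y :: "'i \<Rightarrow> 'a::euclidean_space" and z :: "'j \<Rightarrow> 'a"
  assumes eq: "\<And>x. (\<Sum>i\<in>I. (\<alpha> i * (x \<bullet> y i)) *\<^sub>R y i) = (\<Sum>j\<in>J. (\<beta> j * (x \<bullet> z j)) *\<^sub>R z j)"
    and cy: "(\<Sum>i\<in>I. \<alpha> i *\<^sub>R y i) = 0" and cz: "(\<Sum>j\<in>J. \<beta> j *\<^sub>R z j) = 0"
    and I: "finite I" "I \<noteq> {}" "\<And>i. i \<in> I \<Longrightarrow> \<alpha> i > 0 \<and> norm (y i) = 1"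
    and J: "\<And>j. j \<in> J \<Longrightarrow> \<beta> j > 0 \<and> norm (z j) = 1"
    and W: "linear (W :: 'a \<Rightarrow> 'b::euclidean_space)" "inj W"
    and "\<rho> > 0"
    and inner: "\<And>i. i \<in> I \<Longrightarrow> norm (W (\<rho> *\<^sub>R y i + p)) \<le> 1"
    and outer: "\<And>j. j \<in> J \<Longrightarrow> 1 / norm (W (z j)) \<le> P + q \<bullet> z j"
  shows "\<rho> \<le> P"
proof -
  define \<Lambda> where "\<Lambda> = sum \<alpha> I"
  have "\<Lambda> > 0"
    using I by (auto simp: \<Lambda>_def intro: sum_pos)
  have \<Lambda>': "sum \<beta> J = \<Lambda>"
    using decomposition_trace[OF eq] I(3) J by (auto simp: \<Lambda>_def)
  define Q where "Q = (\<Sum>i\<in>I. \<alpha> i * (norm (W (y i)))\<^sup>2)"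
  have Q': "Q = (\<Sum>j\<in>J. \<beta> j * (norm (W (z j)))\<^sup>2)"
    unfolding Q_def by (rule decomposition_quadratic[OF eq W(1)])
  have "(\<Sum>i\<in>I. \<alpha> i * (\<rho>\<^sup>2 * (norm (W (y i)))\<^sup>2 + 2 * \<rho> * (W (y i) \<bullet> W p))) \<le> (\<Sum>i\<in>I. \<alpha> i * 1)"
  proof (intro sum_mono mult_left_mono)
    fix i assume "i \<in> I"
    have "(norm (W (\<rho> *\<^sub>R y i + p)))\<^sup>2 \<le> 1"
      using inner[OF \<open>i \<in> I\<close>] by (simp add: power_le_one)
    also have "(norm (W (\<rho> *\<^sub>R y i + p)))\<^sup>2
        = \<rho>\<^sup>2 * (norm (W (y i)))\<^sup>2 + 2 * \<rho> * (W (y i) \<bullet> W p) + (norm (W p))\<^sup>2"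
      unfolding power2_norm_eq_inner linear_add[OF W(1)] linear_scale[OF W(1)]
      by (simp add: inner_add inner_commute[of "W p" "W (y i)"] power2_eq_square
          algebra_simps)
    finally show "\<rho>\<^sup>2 * (norm (W (y i)))\<^sup>2 + 2 * \<rho> * (W (y i) \<bullet> W p) \<le> 1"
      by (smt (verit) zero_le_power2)
  qed (use I(3) in force)
  moreover have "(\<Sum>i\<in>I. \<alpha> i * (W (y i) \<bullet> W p)) = W (\<Sum>i\<in>I. \<alpha> i *\<^sub>R y i) \<bullet> W p"
    by (simp add: linear_sum[OF W(1)] linear_scale[OF W(1)] inner_sum_left)
  then have "(\<Sum>i\<in>I. \<alpha> i * (W (y i) \<bullet> W p)) = 0"
    by (simp add: cy linear_0[OF W(1)])
  moreover have "(\<Sum>i\<in>I. \<alpha> i * (\<rho>\<^sup>2 * (norm (W (y i)))\<^sup>2 + 2 * \<rho> * (W (y i) \<bullet> W p)))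
      = \<rho>\<^sup>2 * Q + 2 * \<rho> * (\<Sum>i\<in>I. \<alpha> i * (W (y i) \<bullet> W p))"
    by (simp add: Q_def sum_distrib_left sum.distrib algebra_simps)
  ultimately have inQ: "\<rho>\<^sup>2 * Q \<le> \<Lambda>"
    by (simp add: \<Lambda>_def)
  have "(\<Sum>j\<in>J. \<beta> j * (3 / 2 * \<rho> - \<rho> ^ 3 / 2 * (norm (W (z j)))\<^sup>2)) \<le> (\<Sum>j\<in>J. \<beta> j * (P + q \<bullet> z j))"
  proof (intro sum_mono mult_left_mono)
    fix j assume "j \<in> J"
    then have "W (z j) \<noteq> 0"
      using J W linear_injective_0 by force
    then show "3 / 2 * \<rho> - \<rho> ^ 3 / 2 * (norm (W (z j)))\<^sup>2 \<le> P + q \<bullet> z j"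
      using cubic_tangent_bound[OF \<open>\<rho> > 0\<close>, of "norm (W (z j))"] outer[OF \<open>j \<in> J\<close>] by simp
  qed (use J in force)
  moreover have "(\<Sum>j\<in>J. \<beta> j * (3 / 2 * \<rho> - \<rho> ^ 3 / 2 * (norm (W (z j)))\<^sup>2))
      = 3 / 2 * \<rho> * \<Lambda> - \<rho> ^ 3 / 2 * Q"
    by (simp add: Q' \<Lambda>'[symmetric] sum_distrib_left sum_distrib_right sum_subtractf algebra_simps)
  moreover have "(\<Sum>j\<in>J. \<beta> j * (P + q \<bullet> z j)) = P * \<Lambda> + q \<bullet> (\<Sum>j\<in>J. \<beta> j *\<^sub>R z j)"
    by (simp add: \<Lambda>'[symmetric] sum_distrib_left sum_distrib_right inner_sum_right sum.distrib algebra_simps)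
  ultimately have "3 / 2 * \<rho> * \<Lambda> - \<rho> / 2 * (\<rho>\<^sup>2 * Q) \<le> P * \<Lambda>"
    by (simp add: cz power2_eq_square power3_eq_cube mult.assoc)
  moreover have "\<rho> / 2 * (\<rho>\<^sup>2 * Q) \<le> \<rho> / 2 * \<Lambda>"
    using inQ \<open>\<rho> > 0\<close> by (intro mult_left_mono) auto
  ultimately have "\<rho> * \<Lambda> \<le> P * \<Lambda>"
    by (simp add: algebra_simps)
  then show ?thesis
    using \<open>\<Lambda> > 0\<close> by simp
qed

section \<open>The space of symmetric matrices\<close>

lemma subspace_symmetric_matrices: "subspace {A :: real ^ 'n ^ 'n. transpose A = A}"
  by (auto simp: subspace_def transpose_def vec_eq_iff)

text \<open>
  The matrices \<open>M s\<close> supported on the unordered pairs \<open>s\<close> of indices span the symmetric matrices, and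
  there are \<open>n\<close> singletons and \<open>n choose 2\<close> proper pairs. Indexing by sets avoids choosing an order
  of the index type.
\<close>

lemma dim_symmetric_matrices_le:
  "2 * dim {A :: real ^ 'n ^ 'n. transpose A = A} \<le> CARD('n) * (CARD('n) + 1)"
proof -
  define M :: "'n set \<Rightarrow> real ^ 'n ^ 'n" where "M s = (\<chi> i j. if s = {i, j} then 1 else 0)" for s
  define I where "I = {s::'n set. s \<subseteq> UNIV \<and> card s = 1} \<union> {s. s \<subseteq> UNIV \<and> card s = 2}"
  have pair_in: "{i, j} \<in> I" for i j
    by (cases "i = j") (auto simp: I_def)
  have "A \<in> span (M ` I)" if "transpose A = A" for A
  proof -
    have sym: "A $ i $ j = A $ j $ i" for i j
      using arg_cong[OF that, of "\<lambda>B. B $ i $ j"] by (simp add: transpose_def)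
    define a where "a s = (SOME t. \<exists>i j. s = {i, j} \<and> t = A $ i $ j)" for s
    have a: "a {i, j} = A $ i $ j" for i j
    proof -
      have "\<exists>i' j'. {i, j} = {i', j'} \<and> a {i, j} = A $ i' $ j'"
        unfolding a_def by (rule someI_ex) blast
      then show ?thesis
        using sym by (auto simp: doubleton_eq_iff)
    qed
    have "A $ i $ j = (\<Sum>s\<in>I. a s *\<^sub>R M s) $ i $ j" for i j
    proof -
      have "(\<Sum>s\<in>I. a s *\<^sub>R M s) $ i $ j = (\<Sum>s\<in>I. if s = {i, j} then a s else 0)"
        unfolding sum_component by (intro sum.cong) (auto simp: M_def)
      also have "\<dots> = A $ i $ j"
        using pair_in by (simp add: a)
      finally show ?thesis
        by simp
    qed
    then have "A = (\<Sum>s\<in>I. a s *\<^sub>R M s)"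
      by (simp add: vec_eq_iff)
    also have "\<dots> \<in> span (M ` I)"
      by (intro span_sum span_scale span_base imageI)
    finally show ?thesis .
  qed
  then have "dim {A :: real ^ 'n ^ 'n. transpose A = A} \<le> card (M ` I)"
    by (intro dim_le_card) auto
  also have "\<dots> \<le> card I"
    by (rule card_image_le) simp
  also have "card I = (CARD('n) choose 1) + (CARD('n) choose 2)"
    using n_subsets[of "UNIV :: 'n set" 1] n_subsets[of "UNIV :: 'n set" 2]
    unfolding I_def by (subst card_Un_disjoint) auto
  also have "2 * \<dots> = CARD('n) * (CARD('n) + 1)"
    by (simp add: choose_two) (cases "CARD('n)"; simp)
  finally show ?thesis
    by simp
qed

section \<open>Separation and Caratheodory in the moment space\<close>

definition outer_square :: "real ^ 'n \<Rightarrow> real ^ 'n ^ 'n" where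
  "outer_square x = (\<chi> i j. x $ i * x $ j)"

lemma outer_square_symmetric: "transpose (outer_square x) = outer_square x"
  by (simp add: outer_square_def transpose_def vec_eq_iff mult.commute)

lemma outer_square_mult: "outer_square x *v v = (v \<bullet> x) *\<^sub>R x"
  by (simp add: outer_square_def matrix_vector_mult_def vec_eq_iff inner_vec_def sum_distrib_left
      sum_distrib_right mult_ac)

lemma inner_outer_square: "A \<bullet> outer_square x = x \<bullet> (A *v x)"
  by (simp add: outer_square_def matrix_vector_mult_def inner_vec_def sum_distrib_left mult_ac)

lemma continuous_on_outer_square: "continuous_on S outer_square"
  unfolding outer_square_def[abs_def] by (intro continuous_intros)

text \<open>
  The inner product of a triple \<open>(A, v, w)\<close> with the moment of \<open>y\<close> is \<open>y \<bullet> (A y + v)\<close>, and with that of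
  \<open>z\<close> it is \<open>- (z \<bullet> (A z + w))\<close>. With this sign, a vanishing sum of moments equates the two sides of a
  decomposition, and all points obey a single application of Caratheodory's theorem.
\<close>

definition inner_moment :: "real ^ 'n \<Rightarrow> (real ^ 'n ^ 'n) \<times> (real ^ 'n) \<times> (real ^ 'n)" where
  "inner_moment y = (outer_square y, y, 0)"

definition outer_moment :: "real ^ 'n \<Rightarrow> (real ^ 'n ^ 'n) \<times> (real ^ 'n) \<times> (real ^ 'n)" where
  "outer_moment z = - (outer_square z, 0, z)"

lemma aff_dim_moments_le:
  fixes Y Z :: "(real ^ 'n) set"
  shows "2 * aff_dim (inner_moment ` Y \<union> outer_moment ` Z) \<le> int (CARD('n) * (CARD('n) + 5))"
proof -
  let ?Sym = "{A :: real ^ 'n ^ 'n. transpose A = A}"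
  let ?V = "?Sym \<times> (UNIV :: (real ^ 'n) set) \<times> (UNIV :: (real ^ 'n) set)"
  have "inner_moment y \<in> ?V" "outer_moment y \<in> ?V" for y
    using outer_square_symmetric[of y]
    by (auto simp: inner_moment_def outer_moment_def transpose_def vec_eq_iff)
  then have "aff_dim (inner_moment ` Y \<union> outer_moment ` Z) \<le> aff_dim ?V"
    by (intro aff_dim_subset) blast
  also have "aff_dim ?V = int (dim ?V)"
    by (intro aff_dim_subspace subspace_Times subspace_symmetric_matrices subspace_UNIV)
  finally have "2 * aff_dim (inner_moment ` Y \<union> outer_moment ` Z) \<le> int (2 * dim ?V)"
    by simp
  also have "2 * dim ?V = 2 * dim ?Sym + 4 * CARD('n)"
    by (simp add: dim_Times subspace_Times subspace_symmetric_matrices)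
  also have "\<dots> \<le> CARD('n) * (CARD('n) + 5)"
    using dim_symmetric_matrices_le[where 'n = 'n] by (simp add: algebra_simps)
  finally show ?thesis
    by (simp del: of_nat_mult of_nat_add)
qed

lemma zero_in_moment_hull:
  fixes Y Z :: "(real ^ 'n) set"
  assumes "compact Y" "compact Z"
    and nosep: "\<And>(A :: real ^ 'n ^ 'n) v w. transpose A = A \<Longrightarrow>
      \<exists>y\<in>Y. \<exists>z\<in>Z. y \<bullet> (A *v y + v) \<le> z \<bullet> (A *v z + w)"
  shows "0 \<in> convex hull (inner_moment ` Y \<union> outer_moment ` Z)"
proof (rule ccontr)
  let ?P = "inner_moment ` Y \<union> outer_moment ` Z"
  assume "0 \<notin> convex hull ?P"
  moreover have "compact ?P"
    unfolding inner_moment_def[abs_def] outer_moment_def[abs_def]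
    by (intro compact_Un compact_continuous_image assms continuous_intros continuous_on_outer_square)
  ultimately obtain a b where "0 < b" and ab: "\<And>x. x \<in> convex hull ?P \<Longrightarrow> b < a \<bullet> x"
    using separating_hyperplane_closed_0[of "convex hull ?P"]
    by (metis compact_convex_hull compact_imp_closed convex_convex_hull)
  obtain A v w where a: "a = (A, v, w)"
    by (cases a)
  have pos: "y \<bullet> (A *v y) + v \<bullet> y > 0" if "y \<in> Y" for y
    using ab[OF hull_inc, of "inner_moment y"] that \<open>0 < b\<close>
    by (simp add: a inner_moment_def inner_outer_square)
  have neg: "z \<bullet> (A *v z) + w \<bullet> z < 0" if "z \<in> Z" for z
    using ab[OF hull_inc, of "outer_moment z"] that \<open>0 < b\<close>
    by (simp add: a outer_moment_def inner_outer_square)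
  \<comment> \<open>The separating matrix may be replaced by its symmetric part.\<close>
  define A' where "A' = (1/2) *\<^sub>R (A + transpose A)"
  have "transpose A' = A'"
    by (simp add: A'_def transpose_def vec_eq_iff add.commute)
  have A': "x \<bullet> (A' *v x) = x \<bullet> (A *v x)" for x
  proof -
    have "x \<bullet> (transpose A *v x) = x \<bullet> (A *v x)"
      by (metis dot_lmul_matrix inner_commute transpose_matrix_vector)
    then show ?thesis
      by (simp add: A'_def matrix_vector_mult_add_rdistrib scaleR_matrix_vector_assoc[symmetric] inner_simps)
  qed
  obtain y z where "y \<in> Y" "z \<in> Z" "y \<bullet> (A' *v y + v) \<le> z \<bullet> (A' *v z + w)"
    using nosep[OF \<open>transpose A' = A'\<close>] by blast
  then show False
    using pos[of y] neg[of z] by (simp add: inner_simps A' inner_commute)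
qed

text \<open>
  The three components of a vanishing convex combination of moments are the three equations of a
  decomposition. The trace of the first component shows that both kinds of points occur with
  total weight \<open>1/2\<close>, so neither of the two families is empty.
\<close>

lemma small_contact_decomposition:
  fixes Y Z :: "(real ^ 'n) set"
  assumes Y: "Y \<subseteq> sphere 0 1" and Z: "Z \<subseteq> sphere 0 1"
    and zero: "0 \<in> convex hull (inner_moment ` Y \<union> outer_moment ` Z)"
  shows "\<exists>N M y z \<alpha> \<beta>. contact_decomposition Y Z N M y z \<alpha> \<beta> \<and>
    real (N + M) \<le> real CARD('n) * (real CARD('n) + 5) / 2 + 1"
proof -
  let ?P = "inner_moment ` Y \<union> outer_moment ` Z"
  obtain S u where S: "finite S" "S \<subseteq> ?P" "int (card S) \<le> aff_dim ?P + 1"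
    and u: "\<And>s. s \<in> S \<Longrightarrow> 0 \<le> u s" "sum u S = 1" "(\<Sum>s\<in>S. u s *\<^sub>R s) = 0"
    using zero unfolding convex_hull_caratheodory_aff_dim by blast
  \<comment> \<open>Weights in a decomposition are positive, so points of weight zero are discarded.\<close>
  define S' where "S' = {s \<in> S. u s \<noteq> 0}"
  have fin: "finite S'" and S'P: "S' \<subseteq> ?P" and S'pos: "\<And>s. s \<in> S' \<Longrightarrow> u s > 0"
    using S u(1) by (force simp: S'_def)+
  have sub: "S' \<subseteq> S" "\<forall>s\<in>S - S'. u s = 0"
    by (auto simp: S'_def)
  have u1: "sum u S' = 1"
    using sum.mono_neutral_left[OF S(1) sub] u(2) by simp
  have "\<forall>s\<in>S - S'. u s *\<^sub>R s = 0"
    using sub(2) by simp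
  then have u0: "(\<Sum>s\<in>S'. u s *\<^sub>R s) = 0"
    using sum.mono_neutral_left[OF S(1) sub(1), of "\<lambda>s. u s *\<^sub>R s"] u(3) by simp
  define Y' where "Y' = {y \<in> Y. inner_moment y \<in> S'}"
  define Z' where "Z' = {z \<in> Z. outer_moment z \<in> S'}"
  have injY: "inj_on inner_moment Y'" and injZ: "inj_on outer_moment Z'"
    by (auto simp: inj_on_def inner_moment_def outer_moment_def)
  have S'eq: "S' = inner_moment ` Y' \<union> outer_moment ` Z'"
    using S'P by (auto simp: Y'_def Z'_def)
  have "finite Y'" "finite Z'"
    using fin injY injZ by (auto simp: S'eq dest: finite_imageD)
  have disj: "inner_moment ` Y' \<inter> outer_moment ` Z' = {}"
    using Y by (auto simp: Y'_def inner_moment_def outer_moment_def)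
  define \<alpha> where "\<alpha> y = u (inner_moment y)" for y
  define \<beta> where "\<beta> z = u (outer_moment z)" for z
  have split: "sum f S' = (\<Sum>y\<in>Y'. f (inner_moment y)) + (\<Sum>z\<in>Z'. f (outer_moment z))"
    for f :: "_ \<Rightarrow> 'b::comm_monoid_add"
    unfolding S'eq using \<open>finite Y'\<close> \<open>finite Z'\<close> disj injY injZ
    by (simp add: sum.union_disjoint sum.reindex)
  have zsum: "(\<Sum>y\<in>Y'. \<alpha> y *\<^sub>R inner_moment y) + (\<Sum>z\<in>Z'. \<beta> z *\<^sub>R outer_moment z) = 0"
    using u0 unfolding split by (simp add: \<alpha>_def \<beta>_def)
  have mat: "(\<Sum>y\<in>Y'. \<alpha> y *\<^sub>R outer_square y) = (\<Sum>z\<in>Z'. \<beta> z *\<^sub>R outer_square z)"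
    using arg_cong[OF zsum, of fst]
    by (simp add: fst_sum inner_moment_def outer_moment_def sum_negf)
  have cy: "(\<Sum>y\<in>Y'. \<alpha> y *\<^sub>R y) = 0" and cz: "(\<Sum>z\<in>Z'. \<beta> z *\<^sub>R z) = 0"
    using arg_cong[OF zsum, of "fst \<circ> snd"] arg_cong[OF zsum, of "snd \<circ> snd"]
    by (simp_all add: fst_sum snd_sum inner_moment_def outer_moment_def sum_negf)
  have apply_sum: "(\<Sum>y\<in>T. g y *\<^sub>R outer_square y) *v x = (\<Sum>y\<in>T. (g y * (x \<bullet> y)) *\<^sub>R y)"
    for T and g :: "real ^ 'n \<Rightarrow> real" and x
    by (induction T rule: infinite_finite_induct)
      (simp_all add: matrix_vector_mult_add_rdistrib scaleR_matrix_vector_assoc[symmetric] outer_square_mult)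
  have eq: "(\<Sum>y\<in>Y'. (\<alpha> y * (x \<bullet> y)) *\<^sub>R y) = (\<Sum>z\<in>Z'. (\<beta> z * (x \<bullet> z)) *\<^sub>R z)" for x
    using arg_cong[OF mat, of "\<lambda>B. B *v x"] unfolding apply_sum .
  have trace: "sum \<alpha> Y' = sum \<beta> Z'"
    using Y Z by (intro decomposition_trace[OF eq]) (auto simp: Y'_def Z'_def)
  moreover have "sum \<alpha> Y' + sum \<beta> Z' = 1"
    using u1 unfolding split by (simp add: \<alpha>_def \<beta>_def)
  ultimately have "Y' \<noteq> {}" "Z' \<noteq> {}"
    by auto
  have "card Y' + card Z' = card S'"
    unfolding S'eq using \<open>finite Y'\<close> \<open>finite Z'\<close> disj injY injZ
    by (simp add: card_Un_disjoint card_image)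
  also have "\<dots> \<le> card S"
    unfolding S'_def by (rule card_mono) (use S(1) in auto)
  finally have "2 * int (card Y' + card Z') \<le> 2 * aff_dim ?P + 2"
    using S(3) by simp
  also have "\<dots> \<le> int (CARD('n) * (CARD('n) + 5)) + 2"
    by (rule add_right_mono) (rule aff_dim_moments_le)
  finally have "2 * int (card Y' + card Z') \<le> int (CARD('n) * (CARD('n) + 5)) + 2" .
  then have "2 * real (card Y' + card Z') \<le> real CARD('n) * (real CARD('n) + 5) + 2"
    by (metis (mono_tags, opaque_lifting) of_int_le_iff of_int_add of_int_mult of_int_numeral
        of_int_of_nat_eq of_nat_add of_nat_mult of_nat_numeral)
  then have bound: "real (card Y' + card Z') \<le> real CARD('n) * (real CARD('n) + 5) / 2 + 1"
    by simp
  obtain h k where h: "bij_betw h {1..card Y'} Y'" and k: "bij_betw k {1..card Z'} Z'"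
    using ex_bij_betw_nat_finite_1 \<open>finite Y'\<close> \<open>finite Z'\<close> by metis
  have "contact_decomposition Y Z (card Y') (card Z') h k (\<alpha> \<circ> h) (\<beta> \<circ> k)"
    unfolding contact_decomposition_def
  proof (intro conjI ballI allI)
    show "card Y' \<ge> 1" "card Z' \<ge> 1"
      using \<open>Y' \<noteq> {}\<close> \<open>Z' \<noteq> {}\<close> \<open>finite Y'\<close> \<open>finite Z'\<close> by (simp_all add: Suc_le_eq card_gt_0_iff)
    show "h i \<in> Y" "(\<alpha> \<circ> h) i > 0" if "i \<in> {1..card Y'}" for i
      using bij_betwE[OF h] that S'pos by (auto simp: Y'_def \<alpha>_def)
    show "k j \<in> Z" "(\<beta> \<circ> k) j > 0" if "j \<in> {1..card Z'}" for j
      using bij_betwE[OF k] that S'pos by (auto simp: Z'_def \<beta>_def)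
    show "(\<Sum>i=1..card Y'. ((\<alpha> \<circ> h) i * (x \<bullet> h i)) *\<^sub>R h i)
        = (\<Sum>j=1..card Z'. ((\<beta> \<circ> k) j * (x \<bullet> k j)) *\<^sub>R k j)" for x
      using eq[of x] sum.reindex_bij_betw[OF h, of "\<lambda>y. (\<alpha> y * (x \<bullet> y)) *\<^sub>R y"]
        sum.reindex_bij_betw[OF k, of "\<lambda>z. (\<beta> z * (x \<bullet> z)) *\<^sub>R z"] by simp
    show "(\<Sum>i=1..card Y'. (\<alpha> \<circ> h) i *\<^sub>R h i) = 0"
      using cy sum.reindex_bij_betw[OF h, of "\<lambda>y. \<alpha> y *\<^sub>R y"] by simp
    show "(\<Sum>j=1..card Z'. (\<beta> \<circ> k) j *\<^sub>R k j) = 0"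
      using cz sum.reindex_bij_betw[OF k, of "\<lambda>z. \<beta> z *\<^sub>R z"] by simp
  qed
  with bound show ?thesis
    by blast
qed

section \<open>The equivalence\<close>

lemma affinely_optimal_imp_no_separation:
  fixes L1 L2 :: "(real ^ 'n) set" and A :: "real ^ 'n ^ 'n"
  assumes "convex_body L1" "convex_body L2" "r > 0" "R > 0"
    and opt: "affinely_optimal L1 (cball 0 1) L2 r c R d"
    and sym: "transpose A = A"
  shows "\<exists>y\<in>contact_points (cball 0 1) (homothet r L1 c).
         \<exists>z\<in>contact_points (cball 0 1) (homothet R L2 d).
           y \<bullet> (A *v y + v) \<le> z \<bullet> (A *v z + w)"
proof (rule ccontr)
  let ?K1 = "homothet r L1 c" and ?K2 = "homothet R L2 d"
  assume contr: "\<not> ?thesis"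
  have chain: "?K1 \<subseteq> cball 0 1" "cball 0 1 \<subseteq> ?K2"
    using opt by (auto simp: affinely_optimal_def containment_chain_def)
  have K: "compact ?K1" "convex ?K2" "closed ?K2"
    using assms(1,2) by (auto simp: convex_body_def compact_homothet convex_homothet compact_imp_closed)
  have selfadj: "(A *v x) \<bullet> y = x \<bullet> (A *v y)" for x y
    using dot_lmul_matrix[of x A y] sym transpose_matrix_vector[of A x] by simp
  have "z \<bullet> (A *v z + w) < y \<bullet> (A *v y + v)"
    if "y \<in> ?K1" "norm y = 1" "z \<in> frontier ?K2" "norm z = 1" for y z
  proof -
    have "y \<in> contact_points (cball 0 1) ?K1" "z \<in> contact_points (cball 0 1) ?K2"
      using that contact_points_cball_inside[OF compact_imp_closed[OF K(1)] chain(1)]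
      by (auto simp: contact_points_cball)
    then show ?thesis
      using contr by (meson not_le)
  qed
  then obtain T :: "real ^ 'n \<Rightarrow> real ^ 'n" and \<rho> e where T: "linear T" "\<rho> > 1"
      "\<forall>x\<in>?K1. \<rho> *\<^sub>R (x - e *\<^sub>R v) \<in> T ` cball 0 1"
      "\<forall>x\<in>cball 0 1. T x + e *\<^sub>R w \<in> ?K2"
    by (rule improved_chain[OF matrix_vector_mul_linear selfadj K(1) chain(1) K(2,3) chain(2)]) blast
  have "homothet (\<rho> * r) L1 (\<rho> *\<^sub>R (c - e *\<^sub>R v)) \<subseteq> T ` cball 0 1"
  proof -
    have "(\<rho> * r) *\<^sub>R l + \<rho> *\<^sub>R (c - e *\<^sub>R v) \<in> T ` cball 0 1" if "l \<in> L1" for l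
    proof -
      have "r *\<^sub>R l + c \<in> ?K1"
        unfolding homothet_def using that by (rule imageI)
      then show ?thesis
        using T(3)[rule_format, of "r *\<^sub>R l + c"] by (simp add: algebra_simps)
    qed
    then show ?thesis
      by (auto simp: homothet_def)
  qed
  moreover have "T ` cball 0 1 \<subseteq> homothet R L2 (d - e *\<^sub>R w)"
  proof -
    have "T x \<in> homothet R L2 (d - e *\<^sub>R w)" if x: "x \<in> cball 0 1" for x
    proof -
      obtain l where "l \<in> L2" "T x + e *\<^sub>R w = R *\<^sub>R l + d"
        using T(4)[rule_format, OF x] by (auto simp: homothet_def)
      then show ?thesis
        unfolding homothet_def by (intro image_eqI[of _ _ l]) (simp_all add: algebra_simps)
    qed
    then show ?thesis
      by blast
  qed
  ultimately have "R / r \<le> R / (\<rho> * r)"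
    using opt T(1,2) \<open>r > 0\<close> \<open>R > 0\<close>
    by (auto simp: affinely_optimal_def containment_chain_def
        dest!: spec[of _ T] spec[of _ "\<rho> *\<^sub>R (c - e *\<^sub>R v)"] spec[of _ "d - e *\<^sub>R w"]
          spec[of _ "\<rho> * r"] spec[of _ R])
  then show False
    using T(2) \<open>r > 0\<close> \<open>R > 0\<close> by (simp add: divide_simps)
qed

text \<open>
  A competing chain with factors \<open>r'\<close> and \<open>R'\<close> is rescaled so that it compares \<open>T B\<close> with the bodies
  \<open>r L1 + c\<close> and \<open>R L2 + d\<close> themselves; the factors become \<open>r' / r\<close> and \<open>R' / R\<close>.
\<close>

lemma contact_decomposition_imp_affinely_optimal:
  fixes L1 L2 :: "(real ^ 'n) set"
  assumes "convex_body L1" "convex_body L2" "r > 0" "R > 0"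
    and chain: "containment_chain L1 (cball 0 1) L2 r c R d"
    and dec: "contact_decomposition (contact_points (cball 0 1) (homothet r L1 c))
      (contact_points (cball 0 1) (homothet R L2 d)) N M y z \<alpha> \<beta>"
  shows "affinely_optimal L1 (cball 0 1) L2 r c R d"
  unfolding affinely_optimal_def
proof (intro conjI allI impI)
  show "containment_chain L1 (cball 0 1) L2 r c R d"
    by (rule chain)
next
  fix T :: "real ^ 'n \<Rightarrow> real ^ 'n" and c' d' :: "real ^ 'n" and r' R' :: real
  assume "linear T \<and> 0 < r' \<and> 0 < R' \<and> containment_chain L1 (T ` cball 0 1) L2 r' c' R' d'"
  then have T: "linear T" "r' > 0" "R' > 0" and sub1: "homothet r' L1 c' \<subseteq> T ` cball 0 1"
    and sub2: "T ` cball 0 1 \<subseteq> homothet R' L2 d'"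
    by (auto simp: containment_chain_def)
  have K1: "closed (homothet r L1 c)" "homothet r L1 c \<subseteq> cball 0 1"
    and K2: "convex (homothet R L2 d)" "closed (homothet R L2 d)" "cball 0 1 \<subseteq> homothet R L2 d"
    using assms(1,2) chain
    by (auto simp: convex_body_def compact_homothet convex_homothet compact_imp_closed
        containment_chain_def)
  \<comment> \<open>The image \<open>T ` cball 0 1\<close> contains a body with interior, so \<open>T\<close> cannot be singular.\<close>
  have "surj T"
  proof -
    let ?U = "homothet r' (interior L1) c'"
    have "open ?U"
      using open_affinity[of "interior L1" r' c'] \<open>r' > 0\<close> by (simp add: homothet_def add.commute)
    moreover have "?U \<noteq> {}"
      using assms(1) by (auto simp: homothet_def convex_body_def)
    ultimately have "affine hull ?U = UNIV"
      by (rule affine_hull_open)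
    moreover have "?U \<subseteq> homothet r' L1 c'"
      unfolding homothet_def by (intro image_mono interior_subset)
    then have "?U \<subseteq> range T"
      using sub1 by blast
    then have "affine hull ?U \<subseteq> range T"
      using T(1) by (intro hull_minimal subspace_imp_affine linear_subspace_image subspace_UNIV)
    ultimately show ?thesis
      by blast
  qed
  have "inj T"
    using linear_surjective_imp_injective[OF T(1) \<open>surj T\<close>] by simp
  define W where "W = inv T"
  have "linear W" "inj W"
    using inj_linear_imp_inv_linear[OF T(1) \<open>inj T\<close>] surj_imp_inj_inv[OF \<open>surj T\<close>] by (auto simp: W_def)
  have TW: "T (W x) = x" and WT: "W (T x) = x" for x
    using \<open>surj T\<close> \<open>inj T\<close> by (simp_all add: W_def surj_f_inv_f)
  have y: "y i \<in> homothet r L1 c" "norm (y i) = 1" "\<alpha> i > 0" if "i \<in> {1..N}" for i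
    using that dec K1 by (auto simp: contact_decomposition_def contact_points_cball_inside)
  have z: "z j \<in> frontier (homothet R L2 d)" "norm (z j) = 1" "\<beta> j > 0" if "j \<in> {1..M}" for j
    using that dec by (auto simp: contact_decomposition_def contact_points_cball)
  have "r' / r \<le> R' / R"
  proof (rule decomposition_optimal[where I = "{1..N}" and J = "{1..M}" and \<alpha> = \<alpha> and \<beta> = \<beta>
        and y = y and z = z and W = W
        and p = "c' - (r' / r) *\<^sub>R c" and q = "d' - (R' / R) *\<^sub>R d"])
    fix i assume i: "i \<in> {1..N}"
    obtain l where "l \<in> L1" and l: "y i = r *\<^sub>R l + c"
      using y(1)[OF i] by (auto simp: homothet_def)
    then have "r' *\<^sub>R l + c' \<in> T ` cball 0 1"
      using sub1 by (auto simp: homothet_def)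
    then have "norm (W (r' *\<^sub>R l + c')) \<le> 1"
      by (auto simp: WT)
    then show "norm (W ((r' / r) *\<^sub>R y i + (c' - (r' / r) *\<^sub>R c))) \<le> 1"
      using \<open>r > 0\<close> by (simp add: l algebra_simps)
  next
    fix j assume j: "j \<in> {1..M}"
    let ?x = "(1 / norm (W (z j))) *\<^sub>R z j"
    have "z j \<noteq> 0"
      using z(2)[OF j] by auto
    then have "W (z j) \<noteq> 0"
      using TW linear_0[OF T(1)] by metis
    \<comment> \<open>The point of \<open>T ` cball 0 1\<close> on the ray through the contact point.\<close>
    have "?x = T ((1 / norm (W (z j))) *\<^sub>R W (z j))"
      by (simp only: linear_scale[OF T(1)] TW)
    also have "\<dots> \<in> T ` cball 0 1"
      using \<open>W (z j) \<noteq> 0\<close> by simp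
    finally obtain l where "l \<in> L2" and l: "?x = R' *\<^sub>R l + d'"
      using sub2 by (auto simp: homothet_def)
    have "R *\<^sub>R l + d \<in> homothet R L2 d"
      unfolding homothet_def using \<open>l \<in> L2\<close> by (rule imageI)
    then have le: "(R *\<^sub>R l + d) \<bullet> z j \<le> 1"
      using frontier_outer_contact_le_1[OF K2] z[OF j] by blast
    have "1 / norm (W (z j)) = ?x \<bullet> z j"
      using z(2)[OF j] by (simp add: dot_square_norm)
    also have "?x = (R' / R) *\<^sub>R (R *\<^sub>R l + d) + (d' - (R' / R) *\<^sub>R d)"
      using \<open>R > 0\<close> l by (simp add: algebra_simps)
    also have "\<dots> \<bullet> z j = (R' / R) * ((R *\<^sub>R l + d) \<bullet> z j) + (d' - (R' / R) *\<^sub>R d) \<bullet> z j"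
      by (simp only: inner_add_left inner_scaleR_left)
    also have "\<dots> \<le> R' / R + (d' - (R' / R) *\<^sub>R d) \<bullet> z j"
      using mult_left_mono[OF le, of "R' / R"] \<open>R > 0\<close> \<open>R' > 0\<close> by simp
    finally show "1 / norm (W (z j)) \<le> R' / R + (d' - (R' / R) *\<^sub>R d) \<bullet> z j" .
  qed (use dec y z \<open>linear W\<close> \<open>inj W\<close> \<open>r > 0\<close> \<open>r' > 0\<close> in \<open>auto simp: contact_decomposition_def\<close>)
  then show "R / r \<le> R' / r'"
    using \<open>r > 0\<close> \<open>R > 0\<close> \<open>r' > 0\<close> by (simp add: field_simps)
qed

theorem theorem1p6:
  fixes L1 L2 :: "(real ^ 'n) set" and c d :: "real ^ 'n" and r R :: real
  assumes "convex_body L1" and "convex_body L2"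
    and "r > 0" and "R > 0"
    and "containment_chain L1 (cball 0 1) L2 r c R d"
  shows "(affinely_optimal L1 (cball 0 1) L2 r c R d \<longleftrightarrow>
            (\<forall>(A :: real ^ 'n ^ 'n) v w. transpose A = A \<longrightarrow>
               (\<exists>y\<in>contact_points (cball 0 1) (homothet r L1 c).
                \<exists>z\<in>contact_points (cball 0 1) (homothet R L2 d).
                  y \<bullet> (A *v y + v) \<le> z \<bullet> (A *v z + w))))
       \<and> (affinely_optimal L1 (cball 0 1) L2 r c R d \<longleftrightarrow>
            (\<exists>N M y z \<alpha> \<beta>. contact_decomposition (contact_points (cball 0 1) (homothet r L1 c))
                (contact_points (cball 0 1) (homothet R L2 d)) N M y z \<alpha> \<beta>))
       \<and> (\<forall>N M y z \<alpha> \<beta>. contact_decomposition (contact_points (cball 0 1) (homothet r L1 c))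
                (contact_points (cball 0 1) (homothet R L2 d)) N M y z \<alpha> \<beta> \<longrightarrow>
            (\<Sum>i=1..N. \<alpha> i) = (\<Sum>j=1..M. \<beta> j))
       \<and> ((\<exists>N M y z \<alpha> \<beta>. contact_decomposition (contact_points (cball 0 1) (homothet r L1 c))
                (contact_points (cball 0 1) (homothet R L2 d)) N M y z \<alpha> \<beta>) \<longrightarrow>
            (\<exists>N M y z \<alpha> \<beta>. contact_decomposition (contact_points (cball 0 1) (homothet r L1 c))
                (contact_points (cball 0 1) (homothet R L2 d)) N M y z \<alpha> \<beta> \<and>
               real (N + M) \<le> real CARD('n) * (real CARD('n) + 5) / 2 + 1))"
proof -
  let ?Y = "contact_points (cball 0 1) (homothet r L1 c)"
  let ?Z = "contact_points (cball 0 1) (homothet R L2 d)"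
  let ?optimal = "affinely_optimal L1 (cball 0 1) L2 r c R d"
  let ?nosep = "\<forall>(A :: real ^ 'n ^ 'n) v w. transpose A = A \<longrightarrow>
    (\<exists>y\<in>?Y. \<exists>z\<in>?Z. y \<bullet> (A *v y + v) \<le> z \<bullet> (A *v z + w))"
  let ?decomp = "\<exists>N M y z \<alpha> \<beta>. contact_decomposition ?Y ?Z N M y z \<alpha> \<beta>"
  let ?small = "\<exists>N M y z \<alpha> \<beta>. contact_decomposition ?Y ?Z N M y z \<alpha> \<beta> \<and>
    real (N + M) \<le> real CARD('n) * (real CARD('n) + 5) / 2 + 1"
  have sphere: "?Y \<subseteq> sphere 0 1" "?Z \<subseteq> sphere 0 1"
    by (auto simp: contact_points_cball)
  have compact: "compact ?Y" "compact ?Z"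
    unfolding contact_points_cball by (intro compact_Int_closed compact_sphere frontier_closed)+
  have "?optimal \<Longrightarrow> ?nosep"
    using affinely_optimal_imp_no_separation[OF assms(1-4)] by blast
  moreover have "?nosep \<Longrightarrow> ?small"
    by (intro small_contact_decomposition sphere zero_in_moment_hull compact) blast
  moreover have "?small \<Longrightarrow> ?decomp"
    by blast
  moreover have "?decomp \<Longrightarrow> ?optimal"
    using contact_decomposition_imp_affinely_optimal[OF assms] by blast
  moreover have "(\<Sum>i=1..N. \<alpha> i) = (\<Sum>j=1..M. \<beta> j)"
    if "contact_decomposition ?Y ?Z N M y z \<alpha> \<beta>" for N M y z \<alpha> \<beta>
    using that by (intro decomposition_trace[where y = y and z = z])
      (auto simp: contact_decomposition_def contact_points_cball)
  ultimately show ?thesis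
    by blast
qed

end
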